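(* Let $n\ge 1$ and let $C_n$ be the cyclic anti-phase profile. On $\operatorname{Stab}(C_n)$: (a) if $n$ is odd, there is a unique exactly sex-equal stable matching (i.e. one with $\Delta(\mu)=0$), namely $\mu_{(n-1)/2}$; (b) if $n$ is even, there is no exactly sex-equal stable matching, and the two closest ones (the stable matchings minimizing $|\Delta|$ over $\operatorname{Stab}(C_n)$) are $\mu_{n/2-1}$ and $\mu_{n/2}$, with imbalances $\Delta(\mu_{n/2-1})=-n$ and $\Delta(\mu_{n/2})=+n$.
   Context: A matching between men $m_0,\dots,m_{n-1}$ and women $w_0,\dots,w_{n-1}$, each with a strict total preference order over all participants of the opposite side, is a bijection $\mu$ from men to women. A pair $(m,w)$ blocks $\mu$ if $m$ prefers $w$ to $\mu(m)$ and $w$ prefers $m$ to $\mu^{-1}(w)$; $\mu$ is stable if no pair blocks it; $\operatorname{Stab}(S)$ is the set of stable matchings of a profile $S$. $r_M(m,w)$ is the rank of $w$ in $m$'s list and $r_W(w,m)$ the rank of $m$ in $w$'s list (top choice has rank $1$). Set $E_M(\mu)=\sum_m r_M(m,\mu(m))$, $E_W(\mu)=\sum_w r_W(w,\mu^{-1}(w))$, and the sex-equality imbalance $\Delta(\mu)=E_M(\mu)-E_W(\mu)$. The cyclic anti-phase profile $C_n$ has, with indices modulo $n$, $$m_i:\ w_i\succ w_{i+1}\succ\cdots\succ w_{i-1},\qquad w_j:\ m_{j+1}\succ m_{j+2}\succ\cdots\succ m_j.$$ For $k=0,\dots,n-1$ the shift matching $\mu_k$ is $\mu_k(m_i)=w_{i+k}$.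 *)

theory Defs
  imports Main "HOL-Library.FuncSet"
begin

text \<open>Men and women are both indexed by \<open>{..<n}\<close>. A preference order is given as
  the list of the opposite side, best first; a profile is the pair of the men's and the
  women's preference lists.\<close>

type_synonym profile = "(nat \<Rightarrow> nat list) \<times> (nat \<Rightarrow> nat list)"

abbreviation men_pref :: "profile \<Rightarrow> nat \<Rightarrow> nat list" where
  "men_pref S \<equiv> fst S"

abbreviation women_pref :: "profile \<Rightarrow> nat \<Rightarrow> nat list" where
  "women_pref S \<equiv> snd S"

definition is_profile :: "nat \<Rightarrow> profile \<Rightarrow> bool" where
  "is_profile n S \<longleftrightarrow>
     (\<forall>i<n. distinct (men_pref S i) \<and> set (men_pref S i) = {..<n}) \<and>
     (\<forall>j<n. distinct (women_pref S j) \<and> set (women_pref S j) = {..<n})"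

definition prefers :: "nat list \<Rightarrow> nat \<Rightarrow> nat \<Rightarrow> bool" where
  "prefers xs x y \<longleftrightarrow> (\<exists>i j. i < j \<and> j < length xs \<and> xs ! i = x \<and> xs ! j = y)"

definition rank :: "nat list \<Rightarrow> nat \<Rightarrow> nat" where
  "rank xs x = Suc (length (takeWhile (\<lambda>y. y \<noteq> x) xs))"

text \<open>Matchings are extensional functions, so that two matchings are equal as soon as they
  agree on \<open>{..<n}\<close>.\<close>

definition matchings :: "nat \<Rightarrow> (nat \<Rightarrow> nat) set" where
  "matchings n = {\<mu> \<in> extensional {..<n}. bij_betw \<mu> {..<n} {..<n}}"

definition husband :: "nat \<Rightarrow> (nat \<Rightarrow> nat) \<Rightarrow> nat \<Rightarrow> nat" where
  "husband n \<mu> = inv_into {..<n} \<mu>"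

definition blocks :: "nat \<Rightarrow> profile \<Rightarrow> (nat \<Rightarrow> nat) \<Rightarrow> nat \<Rightarrow> nat \<Rightarrow> bool" where
  "blocks n S \<mu> m w \<longleftrightarrow>
     prefers (men_pref S m) w (\<mu> m) \<and> prefers (women_pref S w) m (husband n \<mu> w)"

definition Stab :: "nat \<Rightarrow> profile \<Rightarrow> (nat \<Rightarrow> nat) set" where
  "Stab n S = {\<mu> \<in> matchings n. \<not> (\<exists>m<n. \<exists>w<n. blocks n S \<mu> m w)}"

definition E_M :: "nat \<Rightarrow> profile \<Rightarrow> (nat \<Rightarrow> nat) \<Rightarrow> nat" where
  "E_M n S \<mu> = (\<Sum>m<n. rank (men_pref S m) (\<mu> m))"

definition E_W :: "nat \<Rightarrow> profile \<Rightarrow> (nat \<Rightarrow> nat) \<Rightarrow> nat" where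
  "E_W n S \<mu> = (\<Sum>w<n. rank (women_pref S w) (husband n \<mu> w))"

definition imbalance :: "nat \<Rightarrow> profile \<Rightarrow> (nat \<Rightarrow> nat) \<Rightarrow> int" where
  "imbalance n S \<mu> = int (E_M n S \<mu>) - int (E_W n S \<mu>)"

definition cyclic_profile :: "nat \<Rightarrow> profile" where
  "cyclic_profile n =
     (\<lambda>i. map (\<lambda>t. (i + t) mod n) [0..<n],
      \<lambda>j. map (\<lambda>t. (j + 1 + t) mod n) [0..<n])"

definition shift_matching :: "nat \<Rightarrow> nat \<Rightarrow> (nat \<Rightarrow> nat)" where
  "shift_matching n k = restrict (\<lambda>i. (i + k) mod n) {..<n}"

lemma distinct_set_cyclic_list:
  fixes a n :: nat
  shows "distinct (map (\<lambda>t. (a + t) mod n) [0..<n])"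
    and "set (map (\<lambda>t. (a + t) mod n) [0..<n]) = {..<n}"
proof -
  have inj: "inj_on (\<lambda>t. (a + t) mod n) {..<n}"
  proof (rule inj_onI)
    fix s t assume "s \<in> {..<n}" "t \<in> {..<n}" and eq: "(a + s) mod n = (a + t) mod n"
    then have lt: "int s < int n" "int t < int n" by auto
    have "(int a + int s) mod int n = (int a + int t) mod int n"
      using eq by (metis of_nat_add of_nat_mod)
    then have "int n dvd (int a + int s) - (int a + int t)"
      by (simp only: mod_eq_dvd_iff)
    then have "int n dvd int s - int t" by simp
    then have "int s mod int n = int t mod int n" by (simp only: mod_eq_dvd_iff)
    then show "s = t" using lt by simp
  qed
  then show "distinct (map (\<lambda>t. (a + t) mod n) [0..<n])"
    by (simp add: distinct_map atLeast0LessThan)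
  have "(\<lambda>t. (a + t) mod n) ` {..<n} \<subseteq> {..<n}" by auto
  then have "(\<lambda>t. (a + t) mod n) ` {..<n} = {..<n}"
    by (rule endo_inj_surj[OF finite_lessThan _ inj])
  then show "set (map (\<lambda>t. (a + t) mod n) [0..<n]) = {..<n}"
    by (simp add: atLeast0LessThan)
qed

lemma is_profile_cyclic_profile: "is_profile n (cyclic_profile n)"
  unfolding is_profile_def cyclic_profile_def fst_conv snd_conv
  using distinct_set_cyclic_list by blast

end

theory Submission
  imports Defs
begin

text \<open>Let \<open>d i\<close> be the cyclic distance from man \<open>i\<close> to his wife. Man \<open>i\<close> ranks woman \<open>w\<close> by the
  distance from \<open>i\<close> to \<open>w\<close>, and \<open>w\<close> ranks \<open>i\<close> by the same distance in the opposite order, so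
  \<open>(i, w)\<close> blocks iff its distance lies strictly between that of \<open>w\<close>'s couple and \<open>d i\<close>.
  Testing \<open>i\<close> against the wife of man \<open>i + 1\<close> gives \<open>d i \<le> d (i + 1) + 1\<close>, with equality excluded
  because it would give both men the same wife. Hence \<open>d\<close> is monotone around the cycle, so constant,
  and the stable matchings are exactly the shifts; the imbalance of \<open>\<mu>\<^sub>k\<close> is \<open>n (2 k + 1 - n)\<close>.\<close>

text \<open>The zero-based position of woman \<open>w\<close> in man \<open>i\<close>'s list. Adding
  \<open>n\<close> first keeps the natural subtraction from truncating when
  \<open>w < i < n\<close>.\<close>

definition cdist :: "nat \<Rightarrow> nat \<Rightarrow> nat \<Rightarrow> nat" where
  "cdist n i w = (w + n - i) mod n"

lemma mod_less_double: "a < 2 * n \<Longrightarrow> a mod n = (if a < n then a else a - n)" for a n :: nat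
  by (simp add: le_mod_geq)

lemma cdist_cases:
  assumes "i < n" "w < n"
  shows "cdist n i w = (if i \<le> w then w - i else w + n - i)"
  using assms by (auto simp: cdist_def mod_less_double)

lemma cdist_less: "i < n \<Longrightarrow> cdist n i w < n"
  by (simp add: cdist_def)

lemma add_cdist: "\<lbrakk>i < n; w < n\<rbrakk> \<Longrightarrow> (i + cdist n i w) mod n = w"
  by (auto simp: cdist_cases)

text \<open>Woman \<open>w\<close>'s list starts at man \<open>w + 1\<close>, at distance
  \<open>n - 1\<close> from her, and the distance falls by one per place, so man \<open>i\<close>
  has position \<open>n - 1 - cdist n i w\<close>.\<close>

lemma add_co_cdist: "\<lbrakk>i < n; w < n\<rbrakk> \<Longrightarrow> (w + 1 + (n - 1 - cdist n i w)) mod n = i"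
  by (auto simp: cdist_cases mod_less_double)

lemma cdist_shift:
  assumes "i < n" "k < n"
  shows "cdist n i ((i + k) mod n) = k"
  using assms by (auto simp: cdist_cases mod_less_double)

text \<open>The last hypothesis rules out \<open>w = i\<close>, where stepping from \<open>i\<close>
  to its successor makes the distance jump from 0 to \<open>n - 1\<close>.\<close>

lemma cdist_Suc:
  assumes "i < n" "w < n" "cdist n (Suc i mod n) w + 1 < n"
  shows "cdist n i w = cdist n (Suc i mod n) w + 1"
  using assms by (cases "Suc i = n") (auto simp: cdist_cases split: if_splits)

section \<open>Ranks and preferences in terms of cyclic distance\<close>

lemma rank_nth:
  assumes "distinct xs" "s < length xs"
  shows "rank xs (xs ! s) = Suc s"
proof -
  have "takeWhile (\<lambda>y. y \<noteq> xs ! s) xs = take s xs"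
    using assms by (intro takeWhile_eq_take_P_nth) (auto simp: nth_eq_iff_index_eq)
  then show ?thesis using assms by (simp add: rank_def)
qed

lemma prefers_nth:
  assumes "distinct xs" "s < length xs" "t < length xs"
  shows "prefers xs (xs ! s) (xs ! t) \<longleftrightarrow> s < t"
proof
  assume "prefers xs (xs ! s) (xs ! t)"
  then obtain i j where "i < j" "j < length xs" "xs ! i = xs ! s" "xs ! j = xs ! t"
    unfolding prefers_def by auto
  then show "s < t" using assms by (auto simp: nth_eq_iff_index_eq)
qed (use assms in \<open>auto simp: prefers_def\<close>)

lemma
  fixes a n :: nat
  defines "xs \<equiv> map (\<lambda>t. (a + t) mod n) [0..<n]"
  assumes "s < n"
  shows rank_cyclic_list: "rank xs ((a + s) mod n) = Suc s"
    and prefers_cyclic_list: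
      "t < n \<Longrightarrow> prefers xs ((a + s) mod n) ((a + t) mod n) \<longleftrightarrow> s < t"
proof -
  have dist: "distinct xs" and len: "length xs = n"
    unfolding xs_def by (rule distinct_set_cyclic_list) simp
  have nth: "xs ! u = (a + u) mod n" if "u < n" for u
    using that by (simp add: xs_def)
  show "rank xs ((a + s) mod n) = Suc s"
    using rank_nth[OF dist] assms nth len by metis
  show "prefers xs ((a + s) mod n) ((a + t) mod n) \<longleftrightarrow> s < t" if "t < n"
    using prefers_nth[OF dist] that assms nth len by metis
qed

lemma rank_men:
  assumes "i < n" "w < n"
  shows "rank (men_pref (cyclic_profile n) i) w = Suc (cdist n i w)"
  using rank_cyclic_list[OF cdist_less[OF assms(1)], of i w] assms
  by (simp add: cyclic_profile_def add_cdist)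

text \<open>With \<open>rank_men\<close>, the two mutual ranks of any pair add up to
  \<open>n + 1\<close>: this is the anti-phase property.\<close>

lemma rank_women:
  assumes "i < n" "w < n"
  shows "rank (women_pref (cyclic_profile n) w) i = n - cdist n i w"
proof -
  have lt: "n - 1 - cdist n i w < n" using assms by simp
  show ?thesis
    using rank_cyclic_list[OF lt, of "w + 1"] cdist_less[OF assms(1), of w]
    unfolding add_co_cdist[OF assms] by (simp add: cyclic_profile_def)
qed

lemma prefers_men:
  assumes "i < n" "w < n" "v < n"
  shows "prefers (men_pref (cyclic_profile n) i) w v \<longleftrightarrow> cdist n i w < cdist n i v"
  using prefers_cyclic_list[of "cdist n i w" n "cdist n i v" i] assms
  by (simp add: cyclic_profile_def add_cdist cdist_less)

lemma prefers_women:
  assumes "i < n" "h < n" "w < n"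
  shows "prefers (women_pref (cyclic_profile n) w) i h \<longleftrightarrow> cdist n h w < cdist n i w"
proof -
  have lt: "n - 1 - cdist n i w < n" "n - 1 - cdist n h w < n" using assms by auto
  show ?thesis
    using prefers_cyclic_list[OF lt, of "w + 1"] cdist_less[OF assms(1), of w]
      cdist_less[OF assms(2), of w]
    unfolding add_co_cdist[OF assms(1,3)] add_co_cdist[OF assms(2,3)]
    by (auto simp: cyclic_profile_def)
qed

lemma husband_matching:
  assumes "\<mu> \<in> matchings n" "h < n"
  shows "husband n \<mu> (\<mu> h) = h"
  using assms by (auto simp: husband_def matchings_def bij_betw_def)

lemma matching_less:
  assumes "\<mu> \<in> matchings n" "h < n"
  shows "\<mu> h < n"
  using assms by (auto simp: matchings_def bij_betw_def)

text \<open>A matching is onto, so each woman can be written as \<open>\<mu> h\<close> with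
  \<open>h\<close> her husband; blocking then compares distances only, without
  \<open>husband\<close>.\<close>

lemma Stab_cyclic_iff:
  "\<mu> \<in> Stab n (cyclic_profile n) \<longleftrightarrow> \<mu> \<in> matchings n \<and>
     (\<forall>i<n. \<forall>h<n. \<not> (cdist n h (\<mu> h) < cdist n i (\<mu> h) \<and> cdist n i (\<mu> h) < cdist n i (\<mu> i)))"
proof (cases "\<mu> \<in> matchings n")
  case True
  then have img: "\<mu> ` {..<n} = {..<n}" by (simp add: matchings_def bij_betw_def)
  have "(\<forall>w\<in>{..<n}. \<not> blocks n (cyclic_profile n) \<mu> i w) \<longleftrightarrow>
      (\<forall>h\<in>{..<n}. \<not> blocks n (cyclic_profile n) \<mu> i (\<mu> h))" for i
    by (subst img[symmetric]) simp
  moreover have "blocks n (cyclic_profile n) \<mu> i (\<mu> h) \<longleftrightarrow>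
      cdist n h (\<mu> h) < cdist n i (\<mu> h) \<and> cdist n i (\<mu> h) < cdist n i (\<mu> i)"
    if "i < n" "h < n" for i h
    unfolding blocks_def using True that
    by (auto simp: husband_matching prefers_men prefers_women matching_less)
  ultimately show ?thesis using True by (simp add: Stab_def Ball_def)
qed (simp add: Stab_def)

lemma cdist_Suc_mono:
  assumes st: "\<mu> \<in> Stab n (cyclic_profile n)" and i: "i < n"
  shows "cdist n i (\<mu> i) \<le> cdist n (Suc i mod n) (\<mu> (Suc i mod n))"
proof (rule ccontr)
  define h where "h = Suc i mod n"
  have h: "h < n" using i by (simp add: h_def)
  have \<mu>: "\<mu> \<in> matchings n" using st by (simp add: Stab_cyclic_iff)
  assume "\<not> ?thesis"
  then have gt: "cdist n h (\<mu> h) < cdist n i (\<mu> i)" by (simp add: h_def)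
  with cdist_less[OF i, of "\<mu> i"] have "cdist n h (\<mu> h) + 1 < n" by linarith
  then have eq: "cdist n i (\<mu> h) = cdist n h (\<mu> h) + 1"
    using cdist_Suc[OF i matching_less[OF \<mu> h]] by (simp only: h_def)
  have "\<not> (cdist n h (\<mu> h) < cdist n i (\<mu> h) \<and> cdist n i (\<mu> h) < cdist n i (\<mu> i))"
    using st i h by (simp add: Stab_cyclic_iff)
  \<comment> \<open>By \<open>eq\<close> the first inequality of a blocking pair holds, so the
    second must fail; \<open>gt\<close> gives the converse bound.\<close>
  with eq gt have "cdist n i (\<mu> h) = cdist n i (\<mu> i)" by linarith
  then have "\<mu> h = \<mu> i"
    using add_cdist[OF i matching_less[OF \<mu> h]] add_cdist[OF i matching_less[OF \<mu> i]] by metis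
  then have "h = i" using husband_matching[OF \<mu> h] husband_matching[OF \<mu> i] by metis
  with gt show False by simp
qed

lemma cdist_const:
  assumes st: "\<mu> \<in> Stab n (cyclic_profile n)" and "i < n" "j < n"
  shows "cdist n i (\<mu> i) = cdist n j (\<mu> j)"
proof -
  have *: "cdist n a (\<mu> a) \<le> cdist n ((a + k) mod n) (\<mu> ((a + k) mod n))" if "a < n" for a k
  proof (induction k)
    case 0
    then show ?case using that by simp
  next
    case (Suc k)
    have "cdist n ((a + k) mod n) (\<mu> ((a + k) mod n))
        \<le> cdist n ((a + Suc k) mod n) (\<mu> ((a + Suc k) mod n))"
      using cdist_Suc_mono[OF st, of "(a + k) mod n"] that by (simp add: mod_Suc_eq)
    with Suc show ?case by linarith
  qed
  \<comment> \<open>Walking \<open>cdist n i j\<close> steps leads from \<open>i\<close> to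
    \<open>j\<close>, and \<open>cdist n j i\<close> steps lead back, which gives both
    inequalities.\<close>
  show ?thesis
    using *[of i "cdist n i j"] *[of j "cdist n j i"] assms by (simp add: add_cdist)
qed

text \<open>The values of the shift are the entries of the cyclic list starting at \<open>k\<close>,
  whose distinctness and range give injectivity and surjectivity.\<close>

lemma shift_matching_in_matchings: "shift_matching n k \<in> matchings n"
proof -
  have "distinct (map (\<lambda>t. (k + t) mod n) [0..<n])"
    "set (map (\<lambda>t. (k + t) mod n) [0..<n]) = {..<n}"
    by (rule distinct_set_cyclic_list)+
  then have "bij_betw (\<lambda>i. (i + k) mod n) {..<n} {..<n}"
    by (simp add: distinct_map bij_betw_def atLeast0LessThan add.commute)
  then have "bij_betw (shift_matching n k) {..<n} {..<n}"
    by (rule bij_betw_cong[THEN iffD1, rotated]) (simp add: shift_matching_def)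
  then show ?thesis by (simp add: matchings_def shift_matching_def)
qed

lemma cdist_shift_matching:
  "\<lbrakk>i < n; k < n\<rbrakk> \<Longrightarrow> cdist n i (shift_matching n k i) = k"
  by (simp add: shift_matching_def cdist_shift)

lemma Stab_cyclic_profile:
  assumes "n \<ge> 1"
  shows "Stab n (cyclic_profile n) = shift_matching n ` {..<n}"
proof (intro subset_antisym subsetI)
  fix \<mu> assume st: "\<mu> \<in> Stab n (cyclic_profile n)"
  then have \<mu>: "\<mu> \<in> matchings n" by (simp add: Stab_cyclic_iff)
  define k where "k = cdist n 0 (\<mu> 0)"
  have "\<mu> i = shift_matching n k i" if "i < n" for i
    using cdist_const[OF st that, of 0] add_cdist[OF that matching_less[OF \<mu> that]] that assms
    by (simp add: k_def shift_matching_def)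
  then have "\<mu> = shift_matching n k"
    using \<mu> by (intro extensionalityI[of _ "{..<n}"]) (auto simp: matchings_def shift_matching_def)
  moreover have "k < n" using assms by (simp add: k_def cdist_less)
  ultimately show "\<mu> \<in> shift_matching n ` {..<n}" by blast
next
  fix \<mu> assume "\<mu> \<in> shift_matching n ` {..<n}"
  \<comment> \<open>All couples of a shift have the same distance \<open>k\<close>, and no distance
    lies strictly between \<open>k\<close> and \<open>k\<close>.\<close>
  then show "\<mu> \<in> Stab n (cyclic_profile n)"
    by (auto simp: Stab_cyclic_iff shift_matching_in_matchings cdist_shift_matching)
qed

text \<open>Each man gives his wife rank \<open>k + 1\<close> and each woman gives her husband rank
  \<open>n - k\<close>; the women's sum is reindexed by their husbands.\<close>

lemma imbalance_shift_matching:
  assumes "k < n"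
  shows "imbalance n (cyclic_profile n) (shift_matching n k) = int n * (2 * int k + 1 - int n)"
proof -
  let ?\<mu> = "shift_matching n k" and ?C = "cyclic_profile n"
  note \<mu> = shift_matching_in_matchings[of n k]
  have "E_M n ?C ?\<mu> = (\<Sum>i<n. Suc k)"
    unfolding E_M_def
    by (rule sum.cong) (auto simp: rank_men matching_less[OF \<mu>] cdist_shift_matching assms)
  moreover have "E_W n ?C ?\<mu> = (\<Sum>i<n. rank (women_pref ?C (?\<mu> i)) (husband n ?\<mu> (?\<mu> i)))"
    unfolding E_W_def using \<mu>
    by (intro sum.reindex_bij_betw[symmetric]) (simp add: matchings_def)
  moreover have "\<dots> = (\<Sum>i<n. n - k)"
    by (rule sum.cong)
      (auto simp: rank_women matching_less[OF \<mu>] husband_matching[OF \<mu>] cdist_shift_matching assms)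
  ultimately show ?thesis
    using assms by (simp add: imbalance_def of_nat_diff algebra_simps)
qed

theorem theorem3p7:
  fixes n :: nat
  assumes "n \<ge> 1"
  shows "(odd n \<longrightarrow>
            {\<mu> \<in> Stab n (cyclic_profile n). imbalance n (cyclic_profile n) \<mu> = 0}
              = {shift_matching n ((n - 1) div 2)})
       \<and> (even n \<longrightarrow>
            \<not> (\<exists>\<mu> \<in> Stab n (cyclic_profile n). imbalance n (cyclic_profile n) \<mu> = 0)
          \<and> {\<mu>. is_arg_min (\<lambda>\<nu>. \<bar>imbalance n (cyclic_profile n) \<nu>\<bar>)
                  (\<lambda>\<nu>. \<nu> \<in> Stab n (cyclic_profile n)) \<mu>}
              = {shift_matching n (n div 2 - 1), shift_matching n (n div 2)}
          \<and> imbalance n (cyclic_profile n) (shift_matching n (n div 2 - 1)) = - int n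
          \<and> imbalance n (cyclic_profile n) (shift_matching n (n div 2)) = int n)"
proof -
  let ?C = "cyclic_profile n" and ?S = "shift_matching n"
  note Stab = Stab_cyclic_profile[OF assms]
  have zero_iff: "imbalance n ?C (?S k) = 0 \<longleftrightarrow> 2 * k + 1 = n" if "k < n" for k
    using that assms by (auto simp: imbalance_shift_matching)
  have odd_part: "{\<mu> \<in> Stab n ?C. imbalance n ?C \<mu> = 0} = {?S ((n - 1) div 2)}" if "odd n"
  proof -
    from \<open>odd n\<close> obtain m where m: "n = 2 * m + 1" by (rule oddE)
    then have "imbalance n ?C (?S k) = 0 \<longleftrightarrow> k = m" if "k < n" for k
      using that zero_iff[of k] by simp
    moreover have "m < n" and half: "(n - 1) div 2 = m" using m by simp_all
    ultimately show ?thesis unfolding Stab half by blast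
  qed
  have even_part: "\<not> (\<exists>\<mu> \<in> Stab n ?C. imbalance n ?C \<mu> = 0)
      \<and> {\<mu>. is_arg_min (\<lambda>\<nu>. \<bar>imbalance n ?C \<nu>\<bar>) (\<lambda>\<nu>. \<nu> \<in> Stab n ?C) \<mu>}
          = {?S (n div 2 - 1), ?S (n div 2)}
      \<and> imbalance n ?C (?S (n div 2 - 1)) = - int n
      \<and> imbalance n ?C (?S (n div 2)) = int n" if "even n"
  proof -
    from \<open>even n\<close> obtain m where m: "n = 2 * m" by (rule evenE)
    have m1: "m \<ge> 1" using m assms by simp
    have lt: "m < n" "m - 1 < n" and half: "n div 2 = m" using m m1 by auto
    have nonzero: "imbalance n ?C (?S k) \<noteq> 0" if "k < n" for k
      using zero_iff[OF that] \<open>even n\<close> by auto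
    have lo: "imbalance n ?C (?S (m - 1)) = - int n"
      using m m1 by (simp add: imbalance_shift_matching of_nat_diff)
    have hi: "imbalance n ?C (?S m) = int n"
      using m m1 by (simp add: imbalance_shift_matching)
    have abs: "\<bar>imbalance n ?C (?S k)\<bar> = int n * \<bar>2 * int k + 1 - int n\<bar>" if "k < n" for k
      using that by (simp add: imbalance_shift_matching abs_mult)
    have ge: "int n \<le> \<bar>imbalance n ?C (?S k)\<bar>" if "k < n" for k
    proof -
      \<comment> \<open>For even \<open>n\<close> this integer is odd, hence nonzero.\<close>
      have "1 \<le> \<bar>2 * int k + 1 - int n\<bar>" using m by presburger
      then show ?thesis using abs[OF that] by (simp add: mult_le_cancel_left1)
    qed
    have eq: "k = m - 1 \<or> k = m" if "k < n" "\<bar>imbalance n ?C (?S k)\<bar> = int n" for k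
    proof -
      \<comment> \<open>Cancelling the positive factor \<open>n\<close> leaves
        \<open>2 * k + 1 - 2 * m\<close> equal to 1 or -1.\<close>
      have "\<bar>2 * int k + 1 - int n\<bar> = 1" using abs[OF that(1)] that(2) assms by simp
      then show ?thesis using m m1 by linarith
    qed
    have mem: "?S (m - 1) \<in> Stab n ?C" "?S m \<in> Stab n ?C" using lt unfolding Stab by auto
    \<comment> \<open>The lower bound \<open>n\<close> from \<open>ge\<close> is attained at
      \<open>?S m\<close>, so it is the minimum.\<close>
    have argmin: "is_arg_min (\<lambda>\<nu>. \<bar>imbalance n ?C \<nu>\<bar>) (\<lambda>\<nu>. \<nu> \<in> Stab n ?C) \<mu>
        \<longleftrightarrow> \<mu> \<in> Stab n ?C \<and> \<bar>imbalance n ?C \<mu>\<bar> = int n" for \<mu>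
    proof
      assume min: "is_arg_min (\<lambda>\<nu>. \<bar>imbalance n ?C \<nu>\<bar>) (\<lambda>\<nu>. \<nu> \<in> Stab n ?C) \<mu>"
      then have st: "\<mu> \<in> Stab n ?C" by (simp add: is_arg_min_def)
      then have "int n \<le> \<bar>imbalance n ?C \<mu>\<bar>" unfolding Stab using ge by auto
      moreover have "\<bar>imbalance n ?C \<mu>\<bar> \<le> int n"
        using min mem(2) hi by (auto simp: is_arg_min_linorder)
      ultimately show "\<mu> \<in> Stab n ?C \<and> \<bar>imbalance n ?C \<mu>\<bar> = int n" using st by simp
    next
      assume "\<mu> \<in> Stab n ?C \<and> \<bar>imbalance n ?C \<mu>\<bar> = int n"
      then show "is_arg_min (\<lambda>\<nu>. \<bar>imbalance n ?C \<nu>\<bar>) (\<lambda>\<nu>. \<nu> \<in> Stab n ?C) \<mu>"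
        unfolding is_arg_min_linorder Stab using ge by auto
    qed
    have "{\<mu> \<in> Stab n ?C. \<bar>imbalance n ?C \<mu>\<bar> = int n} = {?S (m - 1), ?S m}"
    proof (intro subset_antisym subsetI)
      fix \<mu> assume "\<mu> \<in> {\<mu> \<in> Stab n ?C. \<bar>imbalance n ?C \<mu>\<bar> = int n}"
      then obtain k where "k < n" "\<mu> = ?S k" "\<bar>imbalance n ?C (?S k)\<bar> = int n"
        unfolding Stab by auto
      then show "\<mu> \<in> {?S (m - 1), ?S m}" using eq by blast
    qed (use mem lo hi in auto)
    then show ?thesis
      unfolding argmin half using nonzero lo hi by (auto simp: Stab)
  qed
  show ?thesis using odd_part even_part by blast
qed

end
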